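(* Consider the $d$-dimensional flux reconstruction (FR) scheme (see context) on an element with a linear flux function, i.e. $\mathbf F=F(\mathbf u)$ with $F:\mathbb R^{N_s}\to\mathbb R^{dN_s}$ linear. Suppose that the gradient operator is at least first-order accurate, $$\mathbf G\mathbf 1=\mathbf 0,$$ and that the correction (lifting) matrix satisfies $$\mathbf 1^T\mathbf M\mathbf C=\mathbf 1^T\mathbf L_\partial^T\mathbf W_\partial .$$ Then the scheme is conservative, i.e. $$\frac{\mathrm d}{\mathrm dt}\mathbf 1^T\mathbf M\mathbf u=-\mathbf 1^T\mathbf L_\partial^T\mathbf W_\partial(\mathbf n\cdot\mathbf F)^{\mathrm{num}} .$$
   Context: On an element, the solution is represented by its vector $\mathbf u\in\mathbb R^{N_s}$ of values at $N_s$ solution points; $\mathbf 1$ is the vector of ones. $\mathbf M$ is the (symmetric) mass matrix, $\mathbf D_{x_m}$ the differentiation matrices, $\mathbf D=[\mathbf D_{x_1},\dots,\mathbf D_{x_d}]$ the divergence matrix, and $\mathbf G$ the vertical stacking of $\mathbf D_{x_1},\dots,\mathbf D_{x_d}$ (gradient matrix). Notation: $\hat{\mathbf A}=\mathbf I_d\otimes\mathbf A$. $\mathbf L_\partial$ interpolates nodal values to the flux points on the element boundary, $\mathbf W_\partial$ is the surface mass (quadrature) matrix, and $\mathbf N$ maps vector values at the flux points to their outward normal components. The summation-by-parts property holds: $\mathbf M\mathbf D+\mathbf G^T\hat{\mathbf M}=\mathbf L_\partial^T\mathbf W_\partial\mathbf N\hat{\mathbf L}_\partial$. The FR scheme is $$\frac{\mathrm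 d\mathbf u}{\mathrm dt}=-\mathbf D\mathbf F-\mathbf C\big[(\mathbf n\cdot\mathbf F)^{\mathrm{num}}-\mathbf N\hat{\mathbf L}_\partial\mathbf F\big],$$ where $(\mathbf n\cdot\mathbf F)^{\mathrm{num}}$ is the vector of numerical normal fluxes at the flux points and $\mathbf C$ is the correction matrix. "Conservative" means that the element integral $\mathbf 1^T\mathbf M\mathbf u$ changes only through the numerical boundary fluxes, as in the displayed identity (a discrete divergence theorem). *)

theory Defs
  imports "HOL-Analysis.Analysis"
begin

text \<open>
  Index types: \<open>'d\<close> for the space dimensions, \<open>'s\<close> for the solution points, \<open>'f\<close> for the flux
  points.  Nodal vector fields are indexed by pairs (component, point), i.e. they are stacked
  component by component.  The vector of ones is \<open>1 :: real ^ 's\<close>, whose entries are all \<open>1\<close>;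
  the row vector written as its transpose times \<open>A\<close> is \<open>1 v* A\<close>.
\<close>

definition kronecker ::
  "real ^ 'b ^ 'a \<Rightarrow> real ^ 'n ^ 'm \<Rightarrow> real ^ ('b::finite \<times> 'n::finite) ^ ('a::finite \<times> 'm::finite)"
  where "kronecker A B = (\<chi> p q. A $ fst p $ fst q * B $ snd p $ snd q)"

text \<open>The block dimension \<open>'d\<close> occurs only in the result type.\<close>

definition hat :: "real ^ 'n ^ 'm \<Rightarrow> real ^ ('d::finite \<times> 'n::finite) ^ ('d \<times> 'm::finite)"
  where "hat A = kronecker (mat 1 :: real ^ 'd ^ 'd) A"

definition divergence_matrix ::
  "('d::finite \<Rightarrow> real ^ 's ^ 's) \<Rightarrow> real ^ ('d \<times> 's::finite) ^ 's"
  where "divergence_matrix Dx = (\<chi> i q. Dx (fst q) $ i $ snd q)"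

definition gradient_matrix ::
  "('d::finite \<Rightarrow> real ^ 's ^ 's) \<Rightarrow> real ^ 's ^ ('d \<times> 's::finite)"
  where "gradient_matrix Dx = (\<chi> p j. Dx (fst p) $ snd p $ j)"

text \<open>
  \<open>nrm $ k\<close> is the outward normal at the flux point \<open>k\<close>; the matrix sends the values of a vector
  field at the flux points to the inner products with the normals there.  No normalization of the
  normals is imposed.
\<close>

definition normal_matrix :: "(real ^ 'd) ^ 'f \<Rightarrow> real ^ ('d::finite \<times> 'f::finite) ^ 'f"
  where "normal_matrix nrm = (\<chi> k q. if snd q = k then nrm $ k $ fst q else 0)"

definition summation_by_parts ::
  "real ^ 's ^ 's \<Rightarrow> ('d::finite \<Rightarrow> real ^ 's ^ 's) \<Rightarrow> real ^ 's::finite ^ 'f::finite \<Rightarrow> real ^ 'f ^ 'f \<Rightarrow>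
    (real ^ 'd) ^ 'f \<Rightarrow> bool"
  where
  "summation_by_parts M Dx L W nrm \<longleftrightarrow>
    M ** divergence_matrix Dx + transpose (gradient_matrix Dx) ** hat M =
    transpose L ** W ** normal_matrix nrm ** hat L"

definition fr_rhs ::
  "('d::finite \<Rightarrow> real ^ 's ^ 's) \<Rightarrow> real ^ 's::finite ^ 'f::finite \<Rightarrow> (real ^ 'd) ^ 'f \<Rightarrow> real ^ 'f ^ 's \<Rightarrow>
    (real ^ 's \<Rightarrow> real ^ ('d \<times> 's)) \<Rightarrow> real ^ 's \<Rightarrow> real ^ 'f \<Rightarrow> real ^ 's"
  where
  "fr_rhs Dx L nrm C F v fnum =
    - (divergence_matrix Dx *v F v) - C *v (fnum - (normal_matrix nrm ** hat L) *v F v)"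

text \<open>
  The numerical normal fluxes also depend on the states of neighbouring elements; along a solution
  they are some function \<open>fnum\<close> of time, which is left arbitrary.  At an end point of the time
  interval \<open>T\<close> the derivative is one-sided.
\<close>

definition fr_solution ::
  "('d::finite \<Rightarrow> real ^ 's ^ 's) \<Rightarrow> real ^ 's::finite ^ 'f::finite \<Rightarrow> (real ^ 'd) ^ 'f \<Rightarrow> real ^ 'f ^ 's \<Rightarrow>
    (real ^ 's \<Rightarrow> real ^ ('d \<times> 's)) \<Rightarrow> real set \<Rightarrow> (real \<Rightarrow> real ^ 'f) \<Rightarrow> (real \<Rightarrow> real ^ 's) \<Rightarrow> bool"
  where
  "fr_solution Dx L nrm C F T fnum u \<longleftrightarrow>
    (\<forall>t\<in>T. (u has_vector_derivative fr_rhs Dx L nrm C F (u t) (fnum t)) (at t within T))"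

definition fr_conservative ::
  "real ^ 's ^ 's \<Rightarrow> ('d::finite \<Rightarrow> real ^ 's ^ 's) \<Rightarrow> real ^ 's::finite ^ 'f::finite \<Rightarrow> real ^ 'f ^ 'f \<Rightarrow>
    (real ^ 'd) ^ 'f \<Rightarrow> real ^ 'f ^ 's \<Rightarrow> (real ^ 's \<Rightarrow> real ^ ('d \<times> 's)) \<Rightarrow> bool"
  where
  "fr_conservative M Dx L W nrm C F \<longleftrightarrow>
    (\<forall>T fnum u. is_interval T \<longrightarrow> fr_solution Dx L nrm C F T fnum u \<longrightarrow>
      (\<forall>t\<in>T. ((\<lambda>\<tau>. 1 \<bullet> (M *v u \<tau>)) has_real_derivative
        - (1 \<bullet> ((transpose L ** W) *v fnum t))) (at t within T)))"

end

theory Submission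
  imports Defs
begin

text \<open>
  Testing summation by parts against \<open>1\<close> kills the volume term because \<open>G 1 = 0\<close>, so the integrated
  divergence is the boundary integral of the interpolated flux. By the condition on \<open>C\<close>, the
  correction term subtracts exactly this and leaves the numerical flux.
\<close>

lemma inner_one_fr_rhs:
  assumes sbp: "summation_by_parts M Dx L W nrm"
    and grad: "gradient_matrix Dx *v 1 = 0"
    and corr: "1 v* (M ** C) = 1 v* (transpose L ** W)"
  shows "1 \<bullet> (M *v fr_rhs Dx L nrm C F v fnum) = - (1 \<bullet> ((transpose L ** W) *v fnum))"
proof -
  let ?D = "divergence_matrix Dx" and ?G = "gradient_matrix Dx"
    and ?N = "normal_matrix nrm ** hat L" and ?B = "transpose L ** W"
  \<comment> \<open>Moving the transpose to the other side of the inner product turns it into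
    \<open>?G *v 1\<close>, which vanishes: constants have zero discrete gradient.\<close>
  have "1 \<bullet> (transpose ?G *v (hat M *v F v)) = 0"
    by (simp only: dot_lmul_matrix[symmetric] vector_transpose_matrix grad vector_matrix_mult_0 inner_zero_left)
  moreover have "M *v (?D *v F v) + transpose ?G *v (hat M *v F v) = ?B *v (?N *v F v)"
    using arg_cong[OF sbp[unfolded summation_by_parts_def], of "\<lambda>A. A *v F v"]
    by (simp only: matrix_vector_mult_add_rdistrib matrix_vector_mul_assoc[symmetric])
  ultimately have div: "1 \<bullet> (M *v (?D *v F v)) = 1 \<bullet> (?B *v (?N *v F v))"
    using inner_add_right[of 1 "M *v (?D *v F v)" "transpose ?G *v (hat M *v F v)"] by simp
  \<comment> \<open>Stated for every \<open>w\<close> since it serves both halves of the correction: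
    the numerical flux, which survives, and the interpolated flux, whose contribution cancels the
    boundary term from \<open>div\<close>.\<close>
  have lift: "1 \<bullet> (M *v (C *v w)) = 1 \<bullet> (?B *v w)" for w
    by (simp only: matrix_vector_mul_assoc dot_lmul_matrix[symmetric] corr)
  have neg: "M *v (- x) = - (M *v x)" for x
    using matrix_vector_mult_diff_distrib[of M 0 x] by simp
  show ?thesis
    unfolding fr_rhs_def
    by (simp only: matrix_vector_mult_diff_distrib neg inner_diff_right inner_minus_right lift div)
qed

theorem lemma3p6:
  fixes M :: "real ^ 's ^ 's"
    and Dx :: "'d::finite \<Rightarrow> real ^ 's ^ 's"
    and L :: "real ^ 's ^ 'f"
    and W :: "real ^ 'f ^ 'f"
    and nrm :: "(real ^ 'd) ^ 'f"
    and C :: "real ^ 'f ^ 's"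
    and F :: "real ^ 's \<Rightarrow> real ^ ('d \<times> 's)"
  assumes "transpose M = M"
    and "summation_by_parts M Dx L W nrm"
    and "linear F"
    and "gradient_matrix Dx *v 1 = 0"
    and "1 v* (M ** C) = 1 v* (transpose L ** W)"
  shows "fr_conservative M Dx L W nrm C F"
  unfolding fr_conservative_def fr_solution_def
proof (intro allI impI ballI)
  fix T and fnum :: "real \<Rightarrow> real ^ 'f" and u :: "real \<Rightarrow> real ^ 's" and t
  assume "\<forall>t\<in>T. (u has_vector_derivative fr_rhs Dx L nrm C F (u t) (fnum t)) (at t within T)"
    and "t \<in> T"
  then have "(u has_vector_derivative fr_rhs Dx L nrm C F (u t) (fnum t)) (at t within T)"
    by blast
  \<comment> \<open>The element integral is a fixed linear functional of the nodal values, so it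
    commutes with the time derivative, including the one-sided derivative at an end point of
    \<open>T\<close>.\<close>
  moreover have "bounded_linear (\<lambda>v. 1 \<bullet> (M *v v))"
    by (intro bounded_linear_inner_right_comp matrix_vector_mul_bounded_linear)
  ultimately have "((\<lambda>\<tau>. 1 \<bullet> (M *v u \<tau>)) has_vector_derivative
      1 \<bullet> (M *v fr_rhs Dx L nrm C F (u t) (fnum t))) (at t within T)"
    by (rule bounded_linear.has_vector_derivative[rotated])
  then show "((\<lambda>\<tau>. 1 \<bullet> (M *v u \<tau>)) has_real_derivative
      - (1 \<bullet> ((transpose L ** W) *v fnum t))) (at t within T)"
    by (simp only: has_real_derivative_iff_has_vector_derivative inner_one_fr_rhs[OF assms(2,4,5)])
qed

end
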